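(* Let $(f,\Lambda)$ be a generalized $\infty$-eigenpair. If $u\in\operatorname{supp}(V)\cap V_I$, then $f$ satisfies the limit eigenvalue equation at $u$, that is, $$0=\begin{cases}\min\{\|\{\nabla f\}(u)\|_\infty-\Lambda f(u),\ \Delta_\infty f(u)\} & \text{if } f(u)>0,\\ \Delta_\infty f(u) & \text{if } f(u)=0,\\ \max\{-\|\{\nabla f\}(u)\|_\infty-\Lambda f(u),\ \Delta_\infty f(u)\} & \text{if } f(u)<0.\end{cases}$$
   Context: $G=(V,E,\omega)$ is a finite undirected weighted graph: $E\subset V\times V$ is symmetric and $\omega_{uv}=\omega_{vu}>0$ for $(u,v)\in E$; $u\sim v$ means $(u,v)\in E$. $B\subset V$ (possibly empty) is the boundary and $V_I=V\setminus B\neq\emptyset$ the set of internal nodes. $G$ is connected: if $B=\emptyset$ any two nodes are joined by a path; if $B\ne\emptyset$ the subgraph induced by $V_I$ is connected and at least one internal node is adjacent to $B$. $\mathcal H_0(V)=\{f:V\to\mathbb R:\ f=0 \text{ on } B\}$, identified with $\mathbb R^{V_I}$ (extension by zero). For $f\in\mathcal H_0(V)$: $\nabla f(u,v)=\omega_{uv}(f(v)-f(u))$; $\|f\|_\infty=\max_{u\in V}|f(u)|$; $\|\nabla f\|_\infty=\max_{(u,v)\in E}|\nabla f(u,v)|$. With $x^+=\max\{x,0\}$, $x^-=\max\{-x,0\}$: $\|\{\nabla f\}(u)\|_\infty=\max_{v\sim u}|\nabla f(u,v)|$, $\|\{\nabla f\}^{\pm}(u)\|_\infty=\max_{v\sim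 u}(\nabla f(u,v))^{\pm}$, $\Delta_\infty f(u)=\|\{\nabla f\}^-(u)\|_\infty-\|\{\nabla f\}^+(u)\|_\infty$. For $H:E\to\mathbb R$, $\operatorname{div}H(u)=\frac12\sum_{v\sim u}\omega_{uv}(H(u,v)-H(v,u))$ and $\|H\|_{1,E}=\frac12\sum_{(u,v)\in E}|H(u,v)|$; for $\xi:V_I\to\mathbb R$, $\|\xi\|_{1,V}=\sum_{u\in V_I}|\xi(u)|$. $\odot$ is the entrywise product. Generalized $\infty$-eigenpair: $(f,\Lambda)$ with $f\in\mathcal H_0(V)$, $\Lambda\in\mathbb R$, such that $\partial\|\nabla f\|_\infty\cap\Lambda\,\partial\|f\|_\infty\ne\emptyset$, where the sets are the convex subdifferentials at $f$ of $g\mapsto\|\nabla g\|_\infty$ and $g\mapsto\|g\|_\infty$ on $\mathbb R^{V_I}$. $\operatorname{supp}(V)$ (depending on $(f,\Lambda)$): the set of nodes $u\in V$ for which there exist $\nu:V_I\to[0,\infty)$ and $\mu:E\to[0,\infty)$ with $\mu_{uv}=\mu_{vu}$ such that: (i) $-\operatorname{div}(\mu\odot\nabla f)(w)=\Lambda\nu_wf(w)$ for all $w\in V_I$; (ii) $|\nabla f(w,z)|=\|\nabla f\|_\infty$ whenever $\mu_{wz}>0$; (iii) $|f(w)|=\|f\|_\infty$ whenever $\nu_w>0$; (iv) $\|\mu\odot\nabla f\|_{1,E}=1$; (v) $\|\nu\odot f\|_{1,V}=1$; and $\mu_{uv}>0$ for some $v$ with $(u,v)\in E$. *)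

theory Defs
  imports Complex_Main
begin

(* Loops are not excluded. Weights and functions on edges are curried
   functions whose values matter only on E. *)
locale weighted_graph =
  fixes V :: "'a set" and E :: "('a \<times> 'a) set"
    and \<omega> :: "'a \<Rightarrow> 'a \<Rightarrow> real" and B :: "'a set"
  assumes finite_V: "finite V"
    and E_subset: "E \<subseteq> V \<times> V"
    and E_sym: "sym E"
    and weight_sym: "(u, v) \<in> E \<Longrightarrow> \<omega> u v = \<omega> v u"
    and weight_pos: "(u, v) \<in> E \<Longrightarrow> \<omega> u v > 0"
    and B_subset: "B \<subseteq> V"
    and internal_nonempty: "V - B \<noteq> {}"
    and connected_without_boundary:
      "B = {} \<Longrightarrow> u \<in> V \<Longrightarrow> v \<in> V \<Longrightarrow> (u, v) \<in> E\<^sup>*"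
    and connected_internal:
      "B \<noteq> {} \<Longrightarrow> u \<in> V - B \<Longrightarrow> v \<in> V - B \<Longrightarrow>
        (u, v) \<in> (E \<inter> (V - B) \<times> (V - B))\<^sup>*"
    and boundary_adjacent: "B \<noteq> {} \<Longrightarrow> \<exists>u\<in>V - B. \<exists>b\<in>B. (u, b) \<in> E"

(* Real functions on the internal nodes, extended by zero to the whole type:
   this is both H_0(V) and its identification with the coordinate space
   indexed by V - B. *)
definition H0 :: "'a set \<Rightarrow> 'a set \<Rightarrow> ('a \<Rightarrow> real) set" where
  "H0 V B = {f. \<forall>u. u \<notin> V - B \<longrightarrow> f u = 0}"

definition grad :: "('a \<Rightarrow> 'a \<Rightarrow> real) \<Rightarrow> ('a \<Rightarrow> real) \<Rightarrow> 'a \<Rightarrow> 'a \<Rightarrow> real" where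
  "grad \<omega> f u v = \<omega> u v * (f v - f u)"

definition node_sup_norm :: "'a set \<Rightarrow> ('a \<Rightarrow> real) \<Rightarrow> real" where
  "node_sup_norm V f = Max ((\<lambda>u. \<bar>f u\<bar>) ` V)"

(* In the maxima over edges and over neighbours all entries are nonnegative;
   inserting 0 only fixes the value 0 when there are no edges or neighbours. *)
definition grad_sup_norm ::
  "('a \<times> 'a) set \<Rightarrow> ('a \<Rightarrow> 'a \<Rightarrow> real) \<Rightarrow> ('a \<Rightarrow> real) \<Rightarrow> real" where
  "grad_sup_norm E \<omega> f = Max (insert 0 ((\<lambda>(u, v). \<bar>grad \<omega> f u v\<bar>) ` E))"

definition local_grad_norm ::
  "('a \<times> 'a) set \<Rightarrow> ('a \<Rightarrow> 'a \<Rightarrow> real) \<Rightarrow> ('a \<Rightarrow> real) \<Rightarrow> 'a \<Rightarrow> real" where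
  "local_grad_norm E \<omega> f u = Max (insert 0 {\<bar>grad \<omega> f u v\<bar> | v. (u, v) \<in> E})"

definition local_grad_pos_norm ::
  "('a \<times> 'a) set \<Rightarrow> ('a \<Rightarrow> 'a \<Rightarrow> real) \<Rightarrow> ('a \<Rightarrow> real) \<Rightarrow> 'a \<Rightarrow> real" where
  "local_grad_pos_norm E \<omega> f u = Max (insert 0 {max (grad \<omega> f u v) 0 | v. (u, v) \<in> E})"

definition local_grad_neg_norm ::
  "('a \<times> 'a) set \<Rightarrow> ('a \<Rightarrow> 'a \<Rightarrow> real) \<Rightarrow> ('a \<Rightarrow> real) \<Rightarrow> 'a \<Rightarrow> real" where
  "local_grad_neg_norm E \<omega> f u = Max (insert 0 {max (- grad \<omega> f u v) 0 | v. (u, v) \<in> E})"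

definition inf_laplacian ::
  "('a \<times> 'a) set \<Rightarrow> ('a \<Rightarrow> 'a \<Rightarrow> real) \<Rightarrow> ('a \<Rightarrow> real) \<Rightarrow> 'a \<Rightarrow> real" where
  "inf_laplacian E \<omega> f u = local_grad_neg_norm E \<omega> f u - local_grad_pos_norm E \<omega> f u"

definition divergence ::
  "('a \<times> 'a) set \<Rightarrow> ('a \<Rightarrow> 'a \<Rightarrow> real) \<Rightarrow> ('a \<Rightarrow> 'a \<Rightarrow> real) \<Rightarrow> 'a \<Rightarrow> real" where
  "divergence E \<omega> H u = 1 / 2 * (\<Sum>v | (u, v) \<in> E. \<omega> u v * (H u v - H v u))"

definition edge_norm1 :: "('a \<times> 'a) set \<Rightarrow> ('a \<Rightarrow> 'a \<Rightarrow> real) \<Rightarrow> real" where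
  "edge_norm1 E H = 1 / 2 * (\<Sum>(u, v)\<in>E. \<bar>H u v\<bar>)"

definition node_norm1 :: "'a set \<Rightarrow> 'a set \<Rightarrow> ('a \<Rightarrow> real) \<Rightarrow> real" where
  "node_norm1 V B \<xi> = (\<Sum>u\<in>V - B. \<bar>\<xi> u\<bar>)"

definition subdifferential ::
  "'a set \<Rightarrow> 'a set \<Rightarrow> (('a \<Rightarrow> real) \<Rightarrow> real) \<Rightarrow> ('a \<Rightarrow> real) \<Rightarrow> ('a \<Rightarrow> real) set" where
  "subdifferential V B F f =
    {\<xi> \<in> H0 V B. \<forall>g\<in>H0 V B. F g \<ge> F f + (\<Sum>u\<in>V - B. \<xi> u * (g u - f u))}"

definition inf_eigenpair ::
  "'a set \<Rightarrow> ('a \<times> 'a) set \<Rightarrow> ('a \<Rightarrow> 'a \<Rightarrow> real) \<Rightarrow> 'a set \<Rightarrow> ('a \<Rightarrow> real) \<Rightarrow> real \<Rightarrow> bool" where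
  "inf_eigenpair V E \<omega> B f \<Lambda> \<longleftrightarrow> f \<in> H0 V B \<and>
    subdifferential V B (grad_sup_norm E \<omega>) f \<inter>
      (\<lambda>\<xi> u. \<Lambda> * \<xi> u) ` subdifferential V B (node_sup_norm V) f \<noteq> {}"

definition supp_nodes ::
  "'a set \<Rightarrow> ('a \<times> 'a) set \<Rightarrow> ('a \<Rightarrow> 'a \<Rightarrow> real) \<Rightarrow> 'a set \<Rightarrow> ('a \<Rightarrow> real) \<Rightarrow> real \<Rightarrow> 'a set" where
  "supp_nodes V E \<omega> B f \<Lambda> = {u \<in> V. \<exists>(\<nu> :: 'a \<Rightarrow> real) (\<mu> :: 'a \<Rightarrow> 'a \<Rightarrow> real).
      (\<forall>w\<in>V - B. \<nu> w \<ge> 0) \<and>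
      (\<forall>(w, z)\<in>E. \<mu> w z \<ge> 0 \<and> \<mu> w z = \<mu> z w) \<and>
      (\<forall>w\<in>V - B. - divergence E \<omega> (\<lambda>x y. \<mu> x y * grad \<omega> f x y) w = \<Lambda> * \<nu> w * f w) \<and>
      (\<forall>(w, z)\<in>E. \<mu> w z > 0 \<longrightarrow> \<bar>grad \<omega> f w z\<bar> = grad_sup_norm E \<omega> f) \<and>
      (\<forall>w\<in>V - B. \<nu> w > 0 \<longrightarrow> \<bar>f w\<bar> = node_sup_norm V f) \<and>
      edge_norm1 E (\<lambda>x y. \<mu> x y * grad \<omega> f x y) = 1 \<and>
      node_norm1 V B (\<lambda>w. \<nu> w * f w) = 1 \<and>
      (\<exists>v. (u, v) \<in> E \<and> \<mu> u v > 0)}"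

end

theory Submission
  imports Defs
begin

text \<open>
  Write \<open>M\<close> for the gradient norm and \<open>N\<close> for the node norm of \<open>f\<close>. The certificate
  \<open>(\<nu>, \<mu>)\<close> that puts \<open>u\<close> into the support has two consequences.

  Globally, it determines the eigenvalue. Pairing \<open>- div (\<mu> \<odot> \<nabla>f) = \<Lambda> \<nu> \<odot> f\<close> with \<open>f\<close> and
  integrating by parts (\<open>sum_mult_divergence\<close>) gives \<open>M\<close> on the left, because \<open>\<mu>\<close> lives on edges
  where the gradient has size \<open>M\<close> and \<open>\<mu> \<odot> \<nabla>f\<close> has norm one, and \<open>\<Lambda> N\<close> on the right for the same
  reason. Hence \<open>\<Lambda> N = M\<close> (\<open>eigenvalue_from_certificate\<close>).

  Locally, the edge with positive \<open>\<mu>\<close> at \<open>u\<close> makes the local gradient norm equal to \<open>M\<close>, so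
  \<open>M - \<Lambda> \<bar>f u\<bar> \<ge> 0\<close>, with equality exactly when \<open>\<bar>f u\<bar> = N\<close>. If \<open>\<bar>f u\<bar> < N\<close>, then \<open>\<nu>\<close> vanishes
  at \<open>u\<close>, the flow \<open>\<mu> \<odot> \<nabla>f\<close> is balanced there, and what leaves \<open>u\<close> through a steepest
  edge must enter it through another steepest edge: the infinity Laplacian is \<open>M - M = 0\<close>
  (\<open>inf_laplacian_eq_0_if_balanced\<close>). If \<open>\<bar>f u\<bar> = N\<close>, then \<open>u\<close> is an extremum of \<open>f\<close>, all
  gradients at \<open>u\<close> have one sign, and the infinity Laplacian has the opposite one: it is
  nonnegative at a maximum and nonpositive at a minimum, so the vanishing term
  \<open>M - \<Lambda> \<bar>f u\<bar>\<close> decides the minimum or maximum in the equation.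
\<close>

section \<open>Gradient norms and the infinity Laplacian at a node\<close>

context weighted_graph
begin

lemma finite_E: "finite E"
  using finite_V E_subset by (meson finite_SigmaI finite_subset)

lemma finite_neighbours: "finite {v. (u, v) \<in> E}"
  by (rule finite_subset[OF _ finite_V]) (use E_subset in auto)

lemma edge_flip: "(u, v) \<in> E \<Longrightarrow> (v, u) \<in> E"
  using E_sym by (auto dest: symD)

lemma grad_flip: "(u, v) \<in> E \<Longrightarrow> grad \<omega> f v u = - grad \<omega> f u v"
  by (simp add: grad_def weight_sym[of u v] algebra_simps)

lemma grad_le_grad_sup_norm: "(u, v) \<in> E \<Longrightarrow> \<bar>grad \<omega> f u v\<bar> \<le> grad_sup_norm E \<omega> f"
  unfolding grad_sup_norm_def using finite_E by (intro Max_ge) force+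

lemma abs_le_node_sup_norm: "u \<in> V \<Longrightarrow> \<bar>f u\<bar> \<le> node_sup_norm V f"
  unfolding node_sup_norm_def using finite_V by (intro Max_ge) auto

lemma local_grad_norm_eq:
  assumes "(u, v) \<in> E" "\<bar>grad \<omega> f u v\<bar> = grad_sup_norm E \<omega> f"
  shows "local_grad_norm E \<omega> f u = grad_sup_norm E \<omega> f"
  unfolding local_grad_norm_def
proof (rule Max_eqI)
  show "finite (insert 0 {\<bar>grad \<omega> f u v\<bar> |v. (u, v) \<in> E})"
    using finite_neighbours by simp
qed (use assms grad_le_grad_sup_norm in \<open>force+\<close>)

lemma local_grad_pos_norm_eq:
  assumes "(u, v) \<in> E" "grad \<omega> f u v = grad_sup_norm E \<omega> f"
  shows "local_grad_pos_norm E \<omega> f u = grad_sup_norm E \<omega> f"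
  unfolding local_grad_pos_norm_def
proof (rule Max_eqI)
  have M: "grad_sup_norm E \<omega> f \<ge> 0"
    using grad_le_grad_sup_norm[OF assms(1), of f] by linarith
  show "finite (insert 0 {max (grad \<omega> f u v) 0 |v. (u, v) \<in> E})"
    using finite_neighbours by simp
  show "y \<le> grad_sup_norm E \<omega> f" if "y \<in> insert 0 {max (grad \<omega> f u v) 0 |v. (u, v) \<in> E}" for y
    using that M grad_le_grad_sup_norm[of u _ f] by (auto simp: abs_le_iff)
  show "grad_sup_norm E \<omega> f \<in> insert 0 {max (grad \<omega> f u v) 0 |v. (u, v) \<in> E}"
    using assms M by (metis (mono_tags, lifting) insertI2 max.absorb1 mem_Collect_eq)
qed

lemma grad_uminus: "grad \<omega> (\<lambda>x. - f x) u v = - grad \<omega> f u v"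
  by (simp add: grad_def algebra_simps)

lemma grad_sup_norm_uminus: "grad_sup_norm E \<omega> (\<lambda>x. - f x) = grad_sup_norm E \<omega> f"
  by (simp add: grad_sup_norm_def grad_uminus)

lemma local_grad_neg_norm_conv_pos:
  "local_grad_neg_norm E \<omega> f u = local_grad_pos_norm E \<omega> (\<lambda>x. - f x) u"
  by (simp add: local_grad_neg_norm_def local_grad_pos_norm_def grad_uminus)

lemma local_grad_neg_norm_eq:
  assumes "(u, v) \<in> E" "grad \<omega> f u v = - grad_sup_norm E \<omega> f"
  shows "local_grad_neg_norm E \<omega> f u = grad_sup_norm E \<omega> f"
  using local_grad_pos_norm_eq[of u v "\<lambda>x. - f x"] assms
  by (simp add: local_grad_neg_norm_conv_pos grad_uminus grad_sup_norm_uminus)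

lemma local_grad_pos_norm_nonneg: "local_grad_pos_norm E \<omega> f u \<ge> 0"
  unfolding local_grad_pos_norm_def using finite_neighbours by (intro Max_ge) auto

lemma local_grad_pos_norm_eq_0:
  assumes "\<And>v. (u, v) \<in> E \<Longrightarrow> grad \<omega> f u v \<le> 0"
  shows "local_grad_pos_norm E \<omega> f u = 0"
  unfolding local_grad_pos_norm_def
proof (rule Max_eqI)
  show "finite (insert 0 {max (grad \<omega> f u v) 0 |v. (u, v) \<in> E})"
    using finite_neighbours by simp
qed (use assms in \<open>auto simp: max_def\<close>)

lemma inf_laplacian_uminus: "inf_laplacian E \<omega> (\<lambda>x. - f x) u = - inf_laplacian E \<omega> f u"
  by (simp add: inf_laplacian_def local_grad_neg_norm_conv_pos)

lemma inf_laplacian_nonneg_at_max: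
  assumes "u \<in> V" "f u = node_sup_norm V f"
  shows "inf_laplacian E \<omega> f u \<ge> 0"
proof -
  have "grad \<omega> f u v \<le> 0" if e: "(u, v) \<in> E" for v
  proof -
    have "v \<in> V" using e E_subset by auto
    then have "f v - f u \<le> 0" using abs_le_node_sup_norm[of v f] assms by simp
    then show ?thesis using weight_pos[OF e] by (simp add: grad_def mult_le_0_iff)
  qed
  then show ?thesis
    by (simp add: inf_laplacian_def local_grad_pos_norm_eq_0
        local_grad_neg_norm_conv_pos local_grad_pos_norm_nonneg)
qed

lemma inf_laplacian_nonpos_at_min:
  assumes "u \<in> V" "f u = - node_sup_norm V f"
  shows "inf_laplacian E \<omega> f u \<le> 0"
  using inf_laplacian_nonneg_at_max[of u "\<lambda>x. - f x"] assms
  by (simp add: inf_laplacian_uminus node_sup_norm_def)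

section \<open>Balanced flows\<close>

lemma divergence_antisymmetric:
  assumes "\<And>v. (u, v) \<in> E \<Longrightarrow> H v u = - H u v"
  shows "divergence E \<omega> H u = (\<Sum>v | (u, v) \<in> E. \<omega> u v * H u v)"
  unfolding divergence_def sum_distrib_left by (intro sum.cong) (auto simp: assms)

text \<open>
  Zero net flow at \<open>u\<close> together with one active edge forces active edges with gradients of both
  signs, and active edges are steepest edges. So both one-sided norms are attained.
\<close>

lemma inf_laplacian_eq_0_if_balanced:
  assumes balanced: "(\<Sum>v | (u, v) \<in> E. \<omega> u v * (\<mu> v * grad \<omega> f u v)) = 0"
    and nonneg: "\<And>v. (u, v) \<in> E \<Longrightarrow> \<mu> v \<ge> 0"
    and steep: "\<And>v. (u, v) \<in> E \<Longrightarrow> \<mu> v > 0 \<Longrightarrow> \<bar>grad \<omega> f u v\<bar> = grad_sup_norm E \<omega> f"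
    and active: "(u, v0) \<in> E" "\<mu> v0 > 0"
  shows "inf_laplacian E \<omega> f u = 0"
proof -
  let ?M = "grad_sup_norm E \<omega> f"
  let ?t = "\<lambda>v. \<omega> u v * (\<mu> v * grad \<omega> f u v)"
  \<comment> \<open>Balance is invariant under \<open>f \<mapsto> - f\<close>, so one argument yields both signs.\<close>
  have exists_pos: "\<exists>v. (u, v) \<in> E \<and> grad \<omega> g u v = ?M"
    if g: "g = f \<or> g = (\<lambda>x. - f x)" for g
  proof (rule ccontr)
    assume none: "\<nexists>v. (u, v) \<in> E \<and> grad \<omega> g u v = ?M"
    let ?s = "\<lambda>v. \<omega> u v * (\<mu> v * grad \<omega> g u v)"
    have neg: "grad \<omega> g u v < 0" if "(u, v) \<in> E" "\<mu> v > 0" for v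
    proof -
      have "\<bar>grad \<omega> g u v\<bar> = ?M" using steep[OF that] g by (auto simp: grad_uminus)
      moreover have "grad \<omega> g u v \<noteq> ?M" using none that by auto
      ultimately show ?thesis by linarith
    qed
    have "?s v \<le> 0" if "(u, v) \<in> E" for v
      using neg[OF that] nonneg[OF that] weight_pos[OF that]
      by (cases "\<mu> v = 0") (auto simp: mult_le_0_iff)
    moreover have "?s v0 < 0"
      using neg[OF active] active weight_pos[OF active(1)] by (simp add: mult_less_0_iff)
    ultimately have "sum ?s {v. (u, v) \<in> E} < (\<Sum>v | (u, v) \<in> E. 0)"
      using active(1) finite_neighbours by (intro sum_strict_mono_ex1) auto
    moreover have "sum ?s {v. (u, v) \<in> E} = 0"
      using g balanced by (auto simp: grad_uminus sum_negf)
    ultimately show False by simp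
  qed
  obtain v where "(u, v) \<in> E" "grad \<omega> f u v = ?M"
    using exists_pos[of f] by auto
  moreover obtain w where "(u, w) \<in> E" "grad \<omega> f u w = - ?M"
    using exists_pos[of "\<lambda>x. - f x"] by (auto simp: grad_uminus minus_equation_iff)
  ultimately show ?thesis
    by (simp add: inf_laplacian_def local_grad_pos_norm_eq local_grad_neg_norm_eq)
qed

section \<open>Integration by parts and the eigenvalue\<close>

text \<open>
  Integration by parts: splitting the divergence into its two halves and reversing the edges in
  the second one turns \<open>f w\<close> into \<open>f z\<close>. There is no boundary term because \<open>f\<close> vanishes on the
  boundary.
\<close>

lemma sum_mult_divergence:
  assumes "f \<in> H0 V B"
  shows "(\<Sum>w\<in>V - B. f w * divergence E \<omega> H w) = - (1/2) * (\<Sum>(w, z)\<in>E. grad \<omega> f w z * H w z)"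
proof -
  have E_Sigma: "(SIGMA w:V. {z. (w, z) \<in> E}) = E"
    using E_subset by auto
  have "(\<Sum>w\<in>V - B. f w * divergence E \<omega> H w) = (\<Sum>w\<in>V. f w * divergence E \<omega> H w)"
    using assms finite_V by (intro sum.mono_neutral_left) (auto simp: H0_def)
  also have "\<dots> = (\<Sum>w\<in>V. \<Sum>z | (w, z) \<in> E. 1/2 * (\<omega> w z * f w * (H w z - H z w)))"
    by (simp add: divergence_def sum_distrib_left algebra_simps)
  also have "\<dots> = (\<Sum>(w, z)\<in>E. 1/2 * (\<omega> w z * f w * (H w z - H z w)))"
    using finite_V finite_neighbours by (subst sum.Sigma) (auto simp: E_Sigma)
  also have "\<dots> = 1/2 * ((\<Sum>(w, z)\<in>E. \<omega> w z * f w * H w z) - (\<Sum>(w, z)\<in>E. \<omega> w z * f w * H z w))"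
    by (simp add: sum_distrib_left sum_subtractf[symmetric] right_diff_distrib case_prod_unfold)
  also have "(\<Sum>(w, z)\<in>E. \<omega> w z * f w * H z w) = (\<Sum>(w, z)\<in>E. \<omega> w z * f z * H w z)"
    by (rule sum.reindex_bij_witness[where i = prod.swap and j = prod.swap])
      (auto simp: edge_flip weight_sym)
  also have "1/2 * ((\<Sum>(w, z)\<in>E. \<omega> w z * f w * H w z) - (\<Sum>(w, z)\<in>E. \<omega> w z * f z * H w z))
      = - (1/2) * (\<Sum>(w, z)\<in>E. grad \<omega> f w z * H w z)"
    by (simp add: sum_subtractf[symmetric] sum_negf[symmetric] grad_def case_prod_unfold
        algebra_simps)
  finally show ?thesis .
qed

text \<open>
  Both sides are the pairing of the flow equation with \<open>f\<close>; the two normalizations evaluate it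
  because \<open>\<mu>\<close> and \<open>\<nu>\<close> are concentrated where \<open>\<nabla>f\<close> and \<open>f\<close> attain their norms.
\<close>

lemma eigenvalue_from_certificate:
  assumes f: "f \<in> H0 V B"
    and nu: "\<And>w. w \<in> V - B \<Longrightarrow> \<nu> w \<ge> 0"
    and mu: "\<And>w z. (w, z) \<in> E \<Longrightarrow> \<mu> w z \<ge> 0"
    and flow: "\<And>w. w \<in> V - B \<Longrightarrow>
      - divergence E \<omega> (\<lambda>x y. \<mu> x y * grad \<omega> f x y) w = \<Lambda> * \<nu> w * f w"
    and steep: "\<And>w z. (w, z) \<in> E \<Longrightarrow> \<mu> w z > 0 \<Longrightarrow> \<bar>grad \<omega> f w z\<bar> = grad_sup_norm E \<omega> f"
    and peak: "\<And>w. w \<in> V - B \<Longrightarrow> \<nu> w > 0 \<Longrightarrow> \<bar>f w\<bar> = node_sup_norm V f"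
    and mu_norm: "edge_norm1 E (\<lambda>x y. \<mu> x y * grad \<omega> f x y) = 1"
    and nu_norm: "node_norm1 V B (\<lambda>w. \<nu> w * f w) = 1"
  shows "\<Lambda> * node_sup_norm V f = grad_sup_norm E \<omega> f"
proof -
  let ?H = "\<lambda>x y. \<mu> x y * grad \<omega> f x y"
  let ?M = "grad_sup_norm E \<omega> f" and ?N = "node_sup_norm V f"
  have edge: "grad \<omega> f w z * ?H w z = ?M * \<bar>?H w z\<bar>" if "(w, z) \<in> E" for w z
  proof (cases "\<mu> w z = 0")
    case False
    then have "\<mu> w z > 0" using mu[OF that] by simp
    from steep[OF that this] this show ?thesis
      by (simp add: abs_mult flip: abs_mult_self_eq[of "grad \<omega> f w z"])
  qed simp
  have node: "f w * (\<nu> w * f w) = ?N * \<bar>\<nu> w * f w\<bar>" if "w \<in> V - B" for w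
  proof (cases "\<nu> w = 0")
    case False
    then have "\<nu> w > 0" using nu[OF that] by simp
    from peak[OF that this] this show ?thesis
      by (simp add: abs_mult flip: abs_mult_self_eq[of "f w"])
  qed simp
  have "?M = ?M * edge_norm1 E ?H" by (simp add: mu_norm)
  also have "\<dots> = 1/2 * (\<Sum>(w, z)\<in>E. ?M * \<bar>?H w z\<bar>)"
    by (simp add: edge_norm1_def sum_distrib_left case_prod_unfold)
  also have "(\<Sum>(w, z)\<in>E. ?M * \<bar>?H w z\<bar>) = (\<Sum>(w, z)\<in>E. grad \<omega> f w z * ?H w z)"
    by (rule sum.cong[OF refl]) (use edge in auto)
  also have "1/2 * \<dots> = (\<Sum>w\<in>V - B. f w * - divergence E \<omega> ?H w)"
    using sum_mult_divergence[OF f, of ?H] by (simp add: sum_negf)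
  also have "\<dots> = (\<Sum>w\<in>V - B. \<Lambda> * (f w * (\<nu> w * f w)))"
    by (rule sum.cong[OF refl]) (simp only: flow, simp)
  also have "\<dots> = (\<Sum>w\<in>V - B. \<Lambda> * (?N * \<bar>\<nu> w * f w\<bar>))"
    by (rule sum.cong[OF refl]) (simp only: node)
  also have "\<dots> = \<Lambda> * ?N * node_norm1 V B (\<lambda>w. \<nu> w * f w)"
    by (simp add: node_norm1_def sum_distrib_left mult.assoc)
  finally show ?thesis by (simp add: nu_norm)
qed

end

section \<open>The limit eigenvalue equation on the support\<close>

theorem theorem4p12:
  fixes V :: "'a set" and E :: "('a \<times> 'a) set"
    and \<omega> :: "'a \<Rightarrow> 'a \<Rightarrow> real" and B :: "'a set"
    and f :: "'a \<Rightarrow> real" and \<Lambda> :: real and u :: 'a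
  assumes "weighted_graph V E \<omega> B"
    and "inf_eigenpair V E \<omega> B f \<Lambda>"
    and "u \<in> supp_nodes V E \<omega> B f \<Lambda> \<inter> (V - B)"
  shows "0 = (if f u > 0 then
                min (local_grad_norm E \<omega> f u - \<Lambda> * f u) (inf_laplacian E \<omega> f u)
              else if f u = 0 then
                inf_laplacian E \<omega> f u
              else
                max (- local_grad_norm E \<omega> f u - \<Lambda> * f u) (inf_laplacian E \<omega> f u))"
proof -
  interpret weighted_graph V E \<omega> B by fact
  let ?M = "grad_sup_norm E \<omega> f" and ?N = "node_sup_norm V f"
  have f: "f \<in> H0 V B" using assms(2) by (simp add: inf_eigenpair_def)
  have u: "u \<in> V" "u \<in> V - B" using assms(3) by auto
  have "u \<in> supp_nodes V E \<omega> B f \<Lambda>" using assms(3) by blast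
  then obtain \<nu> :: "'a \<Rightarrow> real" and \<mu> :: "'a \<Rightarrow> 'a \<Rightarrow> real" and v0 where
      certificate: "\<forall>w\<in>V - B. \<nu> w \<ge> 0"
      "\<forall>(w, z)\<in>E. \<mu> w z \<ge> 0 \<and> \<mu> w z = \<mu> z w"
      "\<forall>w\<in>V - B. - divergence E \<omega> (\<lambda>x y. \<mu> x y * grad \<omega> f x y) w = \<Lambda> * \<nu> w * f w"
      "\<forall>(w, z)\<in>E. \<mu> w z > 0 \<longrightarrow> \<bar>grad \<omega> f w z\<bar> = ?M"
      "\<forall>w\<in>V - B. \<nu> w > 0 \<longrightarrow> \<bar>f w\<bar> = ?N"
    and mu_norm: "edge_norm1 E (\<lambda>x y. \<mu> x y * grad \<omega> f x y) = 1"
    and nu_norm: "node_norm1 V B (\<lambda>w. \<nu> w * f w) = 1"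
    and active: "(u, v0) \<in> E" "\<mu> u v0 > 0"
    unfolding supp_nodes_def mem_Collect_eq by (elim exE conjE) (rule that)
  have nu: "\<nu> w \<ge> 0"
    and flow: "- divergence E \<omega> (\<lambda>x y. \<mu> x y * grad \<omega> f x y) w = \<Lambda> * \<nu> w * f w"
    and peak: "\<nu> w > 0 \<Longrightarrow> \<bar>f w\<bar> = ?N" if "w \<in> V - B" for w
    using certificate(1,3,5) that by blast+
  have mu: "\<mu> w z \<ge> 0" and mu_sym: "\<mu> w z = \<mu> z w"
    and steep: "\<mu> w z > 0 \<Longrightarrow> \<bar>grad \<omega> f w z\<bar> = ?M" if "(w, z) \<in> E" for w z
    using bspec[OF certificate(2) that] bspec[OF certificate(4) that] by simp_all
  have eigenvalue: "\<Lambda> * ?N = ?M"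
    by (rule eigenvalue_from_certificate[OF f nu mu flow steep peak mu_norm nu_norm])
  have local: "local_grad_norm E \<omega> f u = ?M"
    by (rule local_grad_norm_eq[OF active(1) steep[OF active]])
  have "?M \<ge> 0" using steep[OF active] by linarith
  have fu_le: "\<bar>f u\<bar> \<le> ?N" by (rule abs_le_node_sup_norm[OF u(1)])
  have bound: "\<Lambda> * \<bar>f u\<bar> \<le> ?M"
  proof (cases "?N = 0")
    case True
    then show ?thesis using fu_le \<open>?M \<ge> 0\<close> by simp
  next
    case False
    then have "?N > 0" using fu_le by linarith
    then have "\<Lambda> \<ge> 0" using eigenvalue \<open>?M \<ge> 0\<close> by (metis linorder_not_less mult_less_0_iff)
    then show ?thesis using mult_left_mono[OF fu_le] eigenvalue by metis
  qed
  have balanced: "inf_laplacian E \<omega> f u = 0" if nu_f: "\<nu> u * f u = 0"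
  proof (rule inf_laplacian_eq_0_if_balanced[where \<mu> = "\<mu> u"])
    have "divergence E \<omega> (\<lambda>x y. \<mu> x y * grad \<omega> f x y) u = 0"
      using flow[OF u(2)] nu_f by auto
    then show "(\<Sum>v | (u, v) \<in> E. \<omega> u v * (\<mu> u v * grad \<omega> f u v)) = 0"
      by (subst (asm) divergence_antisymmetric) (auto simp: grad_flip mu_sym)
  qed (use mu steep active in auto)
  have below_peak: "inf_laplacian E \<omega> f u = 0" if "\<bar>f u\<bar> \<noteq> ?N"
    using peak[OF u(2)] nu[OF u(2)] that by (intro balanced) force
  consider "f u > 0" | "f u = 0" | "f u < 0" by linarith
  then show ?thesis
  proof cases
    case 1
    show ?thesis
    proof (cases "f u = ?N")
      case True
      then show ?thesis
        using 1 inf_laplacian_nonneg_at_max[OF u(1) True] eigenvalue local by simp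
    next
      case False
      then show ?thesis using 1 below_peak bound local by simp
    qed
  next
    case 2
    then show ?thesis using balanced by simp
  next
    case 3
    show ?thesis
    proof (cases "f u = - ?N")
      case True
      then show ?thesis
        using 3 inf_laplacian_nonpos_at_min[OF u(1) True] eigenvalue local by simp
    next
      case False
      then show ?thesis using 3 below_peak bound local by simp
    qed
  qed
qed

end
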